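(* Let $P(z)=\sum_{k=-n}^{n}p_kz^k$ be an $m\times m$ matrix Laurent polynomial that is positive definite for every $|z|=1$. Let $\mathcal P=(p_{i-j})_{i,j\in\mathbb Z}=\mathcal C^\dagger\mathcal C$, where $\mathcal C$ is an upper triangular banded block Toeplitz matrix with positive diagonal entries. For $N\ge 0$ let $P_N$ be the $N$th central section of $\mathcal P$, and let $C_N$ be its Cholesky factor, extended by zero to an operator on $\ell_2^m$. Then for every vector $\delta\in\ell_2^m$ with a finite number of nonzero entries there exist constants $K>0$ and $\rho\in(0,1)$, independent of $N$, such that $$\|(C_N-\mathcal C)\delta\|_2<K\rho^N\qquad\text{for all }N .$$
   Context: $\ell_2^m$ is the space of square summable sequences $\mathbf x=(x_i)_{i\in\mathbb Z}$ of $m$-dimensional vectors, with norm $\|\cdot\|_2$. $A^\dagger$ denotes the complex conjugate transpose. A bi-infinite block Toeplitz matrix with $m\times m$ blocks acts as a bounded operator on $\ell_2^m$; it is banded if all blocks with $|i-j|$ larger than some fixed bound vanish. The $N$th central section of $\mathcal P$ is the $(2N+1)m\times(2N+1)m$ matrix $P_N=(p_{i-j})_{-N\le i,j\le N}$. The Cholesky factor of the positive definite matrix $P_N$ is the upper triangular matrix $C_N$ with positive diagonal entries such that $P_N=C_N^\dagger C_N$. A finite matrix $A_N$ with block indices $-N\le i,j\le N$ is extended to an operator on $\ell_2^m$ by setting all other blocks equal to zero, i.e. $\begin{pmatrix}0&0&0\\0&A_N&0\\0&0&0\end{pmatrix}$; the extension is denoted by the same symbol.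
   Formalization: The factor C is additionally assumed to be the spectral one, i.e. det C(z) ≠ 0 for |z|>1 where C(z)=Σ c_k z^k; without this C is not unique and the claim fails, e.g. for P(z)=5−2z−2/z with C(z)=1−2/z. *)

theory Defs
  imports "HOL-Analysis.Analysis"
begin

text \<open>
  Blocks are matrices over an index type \<open>'m\<close> that is finite and linearly ordered, so that
  \<open>CARD('m)\<close> plays the role of \<open>m\<close> and scalar triangularity makes sense. Scalar rows and
  columns of a block matrix are ordered lexicographically by (block index, index in block).
\<close>

type_synonym 'm cblock = "complex ^ 'm ^ 'm"
type_synonym 'm bmatrix = "int \<Rightarrow> int \<Rightarrow> 'm cblock"
type_synonym 'm vseq = "int \<Rightarrow> complex ^ 'm"

definition cadjoint :: "'m::finite cblock \<Rightarrow> 'm cblock" where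
  "cadjoint A = (\<chi> r s. cnj (A $ s $ r))"

definition positive_definite :: "'m::finite cblock \<Rightarrow> bool" where
  "positive_definite A \<longleftrightarrow> cadjoint A = A \<and>
     (\<forall>v. v \<noteq> 0 \<longrightarrow> 0 < Re (\<Sum>r\<in>UNIV. cnj (v $ r) * (A *v v) $ r))"

definition laurent :: "nat \<Rightarrow> (int \<Rightarrow> 'm::finite cblock) \<Rightarrow> complex \<Rightarrow> 'm cblock" where
  "laurent n p z = (\<chi> r s. \<Sum>k = - int n..int n. p k $ r $ s * z powi k)"

definition toeplitz :: "(int \<Rightarrow> 'm::finite cblock) \<Rightarrow> 'm bmatrix" where
  "toeplitz p = (\<lambda>i j. p (i - j))"

definition banded :: "nat \<Rightarrow> 'm::finite bmatrix \<Rightarrow> bool" where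
  "banded b A \<longleftrightarrow> (\<forall>i j. \<bar>i - j\<bar> > int b \<longrightarrow> A i j = 0)"

text \<open>
  The next notions are relative to a set \<open>I\<close> of block indices: \<open>I = UNIV\<close> gives bi-infinite
  matrices and \<open>I = {- int N..int N}\<close> the finite matrices of size \<open>(2 * N + 1) * m\<close>, whose
  values outside \<open>I\<close> are irrelevant.
\<close>

definition upper_triangular_on :: "int set \<Rightarrow> 'm::{finite,linorder} bmatrix \<Rightarrow> bool" where
  "upper_triangular_on I A \<longleftrightarrow>
     (\<forall>i\<in>I. \<forall>j\<in>I. j < i \<longrightarrow> A i j = 0) \<and>
     (\<forall>i\<in>I. \<forall>r s. s < r \<longrightarrow> A i i $ r $ s = 0)"

definition positive_diagonal_on :: "int set \<Rightarrow> 'm::finite bmatrix \<Rightarrow> bool" where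
  "positive_diagonal_on I A \<longleftrightarrow>
     (\<forall>i\<in>I. \<forall>r. Im (A i i $ r $ r) = 0 \<and> 0 < Re (A i i $ r $ r))"

text \<open>
  \<open>A = C\<^sup>\<dagger> C\<close>, with \<open>C\<close> upper triangular with positive diagonal. If \<open>I\<close> is finite or
  \<open>C\<close> is banded, each sum over \<open>k\<close> has only finitely many nonzero terms.
\<close>

definition cholesky_on :: "int set \<Rightarrow> 'm::{finite,linorder} bmatrix \<Rightarrow> 'm bmatrix \<Rightarrow> bool" where
  "cholesky_on I A C \<longleftrightarrow> upper_triangular_on I C \<and> positive_diagonal_on I C \<and>
     (\<forall>i\<in>I. \<forall>j\<in>I. A i j = (\<Sum>\<^sub>\<infinity>k\<in>I. cadjoint (C k i) ** C k j))"

definition central :: "nat \<Rightarrow> int set" where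
  "central N = {- int N..int N}"

definition zero_extend :: "nat \<Rightarrow> 'm::finite bmatrix \<Rightarrow> 'm bmatrix" where
  "zero_extend N A = (\<lambda>i j. if i \<in> central N \<and> j \<in> central N then A i j else 0)"

text \<open>
  The factorization \<open>\<P> = \<C>\<^sup>\<dagger> \<C>\<close> with \<open>\<C> = toeplitz c\<close> banded and upper triangular with
  positive diagonal does not determine \<open>\<C>\<close>: for \<open>m = 1\<close> and \<open>P(z) = 5 - 2 z - 2 / z\<close> both
  \<open>C(z) = 2 - 1 / z\<close> and \<open>C(z) = 1 - 2 / z\<close> qualify. The factor meant is the canonical one,
  whose inverse is upper triangular as well. Since \<open>C(z)\<close> is a polynomial in \<open>1 / z\<close>, this
  says that \<open>det C(z)\<close> has no zero outside the unit disc; zeros on the unit circle are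
  excluded by positive definiteness of \<open>P\<close>.
\<close>

definition canonical_symbol :: "nat \<Rightarrow> (int \<Rightarrow> 'm::finite cblock) \<Rightarrow> bool" where
  "canonical_symbol b c \<longleftrightarrow> (\<forall>z. cmod z > 1 \<longrightarrow> det (laurent b c z) \<noteq> 0)"

definition ell2 :: "'m::finite vseq set" where
  "ell2 = {x. (\<lambda>i. (norm (x i))\<^sup>2) summable_on UNIV}"

definition ell2_norm :: "'m::finite vseq \<Rightarrow> real" where
  "ell2_norm x = sqrt (\<Sum>\<^sub>\<infinity>i. (norm (x i))\<^sup>2)"

definition bmatrix_apply :: "'m::finite bmatrix \<Rightarrow> 'm vseq \<Rightarrow> 'm vseq" where
  "bmatrix_apply A x = (\<lambda>i. \<Sum>\<^sub>\<infinity>j. A i j *v x j)"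

end

theory Submission
  imports Defs "HOL-Complex_Analysis.Complex_Analysis"
begin

unbundle no fps_syntax

text \<open>
  The coefficients of \<open>C(z)\<^sup>-\<^sup>1\<close>, a power series in \<open>1 / z\<close>, decay exponentially, because \<open>det C\<close>
  has no zero in \<open>\<bar>z\<bar> \<ge> 1\<close>. Let \<open>u\<close> be the truncation to the section of column \<open>j\<close> of \<open>\<C>\<^sup>-\<^sup>1\<close>.
  Then \<open>\<C> u = e\<^sub>j + \<epsilon>\<close>, where \<open>\<epsilon>\<close> lives on the \<open>b\<close> block rows just above the section and is
  exponentially small in \<open>N\<close>. Since \<open>C\<^sub>N\<close> and \<open>\<C>\<close> have the same Gram matrix on vectors supported
  in the section and both are triangular, \<open>C\<^sub>N u\<close> differs from \<open>e\<^sub>j\<close> by at most \<open>\<surd>2 \<parallel>\<epsilon>\<parallel>\<close>.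
  Finally \<open>\<delta>\<close> is a fixed finite combination of these columns, namely \<open>\<C>\<^sup>-\<^sup>1 (\<C> \<delta>)\<close>.
\<close>

subsection \<open>Triangular factors with equal Gram matrices\<close>

lemma triangular_solvable:
  fixes U :: "'k \<Rightarrow> 'k \<Rightarrow> complex" and prec :: "'k \<Rightarrow> 'k \<Rightarrow> bool"
  assumes "finite J" and "transp prec" and "irreflp prec"
    and tri: "\<And>a b. a \<in> J \<Longrightarrow> b \<in> J \<Longrightarrow> a \<noteq> b \<Longrightarrow> \<not> prec a b \<Longrightarrow> U a b = 0"
    and diag: "\<And>a. a \<in> J \<Longrightarrow> U a a \<noteq> 0"
  shows "\<exists>x. \<forall>a\<in>J. (\<Sum>b\<in>J. U a b * x b) = y a"
  using assms(1) tri diag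
proof (induction J arbitrary: y rule: finite_psubset_induct)
  case (psubset J)
  show ?case
  proof (cases "J = {}")
    case False
    have "asymp_on J prec"
      using assms(2,3) by (auto intro!: asymp_onI dest: transpD irreflpD)
    moreover have "transp_on J prec"
      using assms(2) by (rule transp_on_subset) simp
    ultimately obtain m where m: "m \<in> J" "\<And>x. x \<in> J \<Longrightarrow> x \<noteq> m \<Longrightarrow> \<not> prec m x"
      using Finite_Set.bex_max_element[of J prec] psubset.hyps(1) False by blast
    have fin: "finite (J - {m})"
      using psubset.hyps(1) by simp
    define z where "z = y m / U m m"
    have "\<exists>x. \<forall>a\<in>J - {m}. (\<Sum>b\<in>J - {m}. U a b * x b) = y a - U a m * z"
      by (rule psubset.IH) (use m psubset.prems in auto)
    then obtain x where x: "\<And>a. a \<in> J - {m} \<Longrightarrow> (\<Sum>b\<in>J - {m}. U a b * x b) = y a - U a m * z"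
      by blast
    have split: "(\<Sum>b\<in>J. U a b * (x(m := z)) b) = U a m * z + (\<Sum>b\<in>J - {m}. U a b * x b)" for a
      using psubset.hyps(1) m(1) by (subst sum.remove[of _ m]) (auto intro!: sum.cong)
    have "(\<Sum>b\<in>J. U a b * (x(m := z)) b) = y a" if "a \<in> J" for a
    proof (cases "a = m")
      case True
      have "(\<Sum>b\<in>J - {m}. U m b * x b) = 0"
        using m psubset.prems(1) by (intro sum.neutral) auto
      then show ?thesis
        using True split[of a] psubset.prems(2)[OF m(1)] by (simp add: z_def)
    next
      case False
      then show ?thesis
        using split[of a] x[of a] that by simp
    qed
    then show ?thesis by blast
  qed auto
qed

lemma triangular_kernel_support:
  fixes U :: "'k \<Rightarrow> 'k \<Rightarrow> complex" and prec :: "'k \<Rightarrow> 'k \<Rightarrow> bool"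
  assumes "finite J" and ord: "transp prec" "irreflp prec"
    and tri: "\<And>a b. a \<in> J \<Longrightarrow> b \<in> J \<Longrightarrow> a \<noteq> b \<Longrightarrow> \<not> prec a b \<Longrightarrow> U a b = 0"
    and diag: "\<And>a. a \<in> J \<Longrightarrow> U a a \<noteq> 0"
    and eq: "\<And>a. a \<in> J \<Longrightarrow> a \<noteq> j \<Longrightarrow> \<not> prec a j \<Longrightarrow> (\<Sum>b\<in>J. U a b * x b) = 0"
    and a: "a \<in> J" "a \<noteq> j" "\<not> prec a j"
  shows "x a = 0"
proof (rule ccontr)
  assume "x a \<noteq> 0"
  define S where "S = {b \<in> J. b \<noteq> j \<and> \<not> prec b j \<and> x b \<noteq> 0}"
  have "finite S" "S \<noteq> {}"
    using a \<open>x a \<noteq> 0\<close> \<open>finite J\<close> by (auto simp: S_def)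
  moreover have "asymp_on S prec"
    using ord by (auto intro!: asymp_onI dest: transpD irreflpD)
  moreover have "transp_on S prec"
    using ord(1) by (rule transp_on_subset) simp
  ultimately obtain m where m: "m \<in> S" "\<And>b. b \<in> S \<Longrightarrow> b \<noteq> m \<Longrightarrow> \<not> prec m b"
    using Finite_Set.bex_max_element[of S prec] by blast
  have mJ: "m \<in> J" "m \<noteq> j" "\<not> prec m j" "x m \<noteq> 0"
    using m(1) by (auto simp: S_def)
  have "U m b * x b = 0" if b: "b \<in> J - {m}" for b
  proof (cases "prec m b \<and> x b \<noteq> 0")
    case True
    then have "b \<noteq> j" "\<not> prec b j"
      using mJ transpD[OF ord(1), of m b j] by auto
    then show ?thesis
      using True m(2)[of b] b by (auto simp: S_def)
  qed (use tri[of m b] mJ b in auto)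
  then have "(\<Sum>b\<in>J - {m}. U m b * x b) = 0"
    by (intro sum.neutral) simp
  then have "(\<Sum>b\<in>J. U m b * x b) = U m m * x m"
    using \<open>finite J\<close> mJ(1) by (simp add: sum.remove[of J m])
  then show False
    using eq[OF mJ(1-3)] diag[OF mJ(1)] mJ(4) by simp
qed

lemma gram_form:
  fixes U C :: "'k \<Rightarrow> 'k \<Rightarrow> complex" and x y :: "'k \<Rightarrow> complex"
  assumes gram: "\<And>a b. a \<in> J \<Longrightarrow> b \<in> J \<Longrightarrow>
      (\<Sum>k\<in>J. cnj (U k a) * U k b) = (\<Sum>k\<in>J'. cnj (C k a) * C k b)"
  shows "(\<Sum>k\<in>J. cnj (\<Sum>a\<in>J. U k a * x a) * (\<Sum>b\<in>J. U k b * y b)) =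
         (\<Sum>k\<in>J'. cnj (\<Sum>a\<in>J. C k a * x a) * (\<Sum>b\<in>J. C k b * y b))"
proof -
  have swap: "(\<Sum>k\<in>S. cnj (\<Sum>a\<in>J. A k a * x a) * (\<Sum>b\<in>J. A k b * y b)) =
      (\<Sum>a\<in>J. \<Sum>b\<in>J. cnj (x a) * y b * (\<Sum>k\<in>S. cnj (A k a) * A k b))"
    for A :: "'k \<Rightarrow> 'k \<Rightarrow> complex" and S
  proof -
    have "(\<Sum>k\<in>S. cnj (\<Sum>a\<in>J. A k a * x a) * (\<Sum>b\<in>J. A k b * y b)) =
        (\<Sum>k\<in>S. \<Sum>a\<in>J. \<Sum>b\<in>J. cnj (x a) * y b * (cnj (A k a) * A k b))"
      unfolding cnj_sum sum_product by (intro sum.cong refl) (simp add: mult_ac)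
    also have "\<dots> = (\<Sum>a\<in>J. \<Sum>k\<in>S. \<Sum>b\<in>J. cnj (x a) * y b * (cnj (A k a) * A k b))"
      by (rule sum.swap)
    also have "\<dots> = (\<Sum>a\<in>J. \<Sum>b\<in>J. \<Sum>k\<in>S. cnj (x a) * y b * (cnj (A k a) * A k b))"
      by (intro sum.cong refl sum.swap)
    finally show ?thesis by (simp add: sum_distrib_left)
  qed
  show ?thesis
    unfolding swap by (intro sum.cong refl) (simp add: gram)
qed

lemma sum_cnj_mult_self:
  "(\<Sum>k\<in>S. cnj (f k) * f k) = of_real (\<Sum>k\<in>S. (cmod (f k))\<^sup>2)"
  unfolding of_real_sum
  by (intro sum.cong refl) (metis complex_norm_square mult.commute)

lemma cmod_sum_cnj_mult_squared_le:
  "(cmod (\<Sum>k\<in>S. cnj (f k) * g k))\<^sup>2 \<le> (\<Sum>k\<in>S. (cmod (f k))\<^sup>2) * (\<Sum>k\<in>S. (cmod (g k))\<^sup>2)"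
proof -
  have "cmod (\<Sum>k\<in>S. cnj (f k) * g k) \<le> (\<Sum>k\<in>S. cmod (f k) * cmod (g k))"
    by (rule sum_norm_le) (simp add: norm_mult)
  then have "(cmod (\<Sum>k\<in>S. cnj (f k) * g k))\<^sup>2 \<le> (\<Sum>k\<in>S. cmod (f k) * cmod (g k))\<^sup>2"
    by (rule power_mono) simp
  also have "\<dots> \<le> (\<Sum>k\<in>S. (cmod (f k))\<^sup>2) * (\<Sum>k\<in>S. (cmod (g k))\<^sup>2)"
    by (rule Cauchy_Schwarz_ineq_sum)
  finally show ?thesis .
qed

text \<open>
  Solving \<open>U x = y\<^sub><\<close> for the part \<open>y\<^sub><\<close> of \<open>y = U u\<close> before \<open>j\<close> and comparing \<open>\<langle>U x, U u\<rangle>\<close> with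
  \<open>\<langle>C x, C u\<rangle>\<close>, in which only \<open>\<epsilon>\<close> survives, gives \<open>\<parallel>y\<^sub><\<parallel> \<le> \<parallel>\<epsilon>\<parallel>\<close>; the entry \<open>y\<^sub>j > 0\<close> is then
  controlled by \<open>\<parallel>y\<parallel>\<^sup>2 = 1 + \<parallel>\<epsilon>\<parallel>\<^sup>2\<close>.
\<close>

schematic_goal triangular_gram_column_bound:
  fixes U C :: "'k \<Rightarrow> 'k \<Rightarrow> complex" and u :: "'k \<Rightarrow> complex" and prec :: "'k \<Rightarrow> 'k \<Rightarrow> bool"
  assumes fin: "finite J'" and "J \<subseteq> J'" and ord: "transp prec" "irreflp prec" and j: "j \<in> J"
    and Utri: "\<And>a b. a \<in> J \<Longrightarrow> b \<in> J \<Longrightarrow> a \<noteq> b \<Longrightarrow> \<not> prec a b \<Longrightarrow> U a b = 0"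
    and Udiag: "\<And>a. a \<in> J \<Longrightarrow> Im (U a a) = 0 \<and> 0 < Re (U a a)"
    and gram: "\<And>a b. a \<in> J \<Longrightarrow> b \<in> J \<Longrightarrow>
      (\<Sum>k\<in>J. cnj (U k a) * U k b) = (\<Sum>k\<in>J'. cnj (C k a) * C k b)"
    and Ctri: "\<And>a b. a \<in> J \<Longrightarrow> b \<in> J \<Longrightarrow> a \<noteq> b \<Longrightarrow> \<not> prec a b \<Longrightarrow> C a b = 0"
    and Cdiag: "\<And>a. a \<in> J \<Longrightarrow> Im (C a a) = 0 \<and> 0 < Re (C a a)"
    and Cu: "\<And>a. a \<in> J \<Longrightarrow> (\<Sum>b\<in>J. C a b * u b) = (if a = j then 1 else 0)"
  shows "(\<Sum>a\<in>J. (cmod ((\<Sum>b\<in>J. U a b * u b) - (if a = j then 1 else 0)))\<^sup>2) \<le>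
    ?C * (\<Sum>a\<in>J' - J. (cmod (\<Sum>b\<in>J. C a b * u b))\<^sup>2)"
proof -
  have finJ: "finite J"
    using fin \<open>J \<subseteq> J'\<close> by (rule rev_finite_subset)
  have asym: "\<not> prec a b" if "prec b a" for a b
    using that ord by (meson irreflpD transpD)
  have usupp: "u b = 0" if "b \<in> J" "b \<noteq> j" "\<not> prec b j" for b
  proof (rule triangular_kernel_support[where U = C and J = J and j = j, OF finJ ord])
    show "C a b = 0" if "a \<in> J" "b \<in> J" "a \<noteq> b" "\<not> prec a b" for a b
      using that by (rule Ctri)
    show "C a a \<noteq> 0" if "a \<in> J" for a
      using Cdiag[OF that] by (auto simp: complex_eq_iff)
    show "(\<Sum>b\<in>J. C a b * u b) = 0" if "a \<in> J" "a \<noteq> j" for a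
      using Cu[OF that(1)] that(2) by simp
  qed fact+
  define Jl where "Jl = {a \<in> J. prec a j}"
  have Jl: "Jl \<subseteq> J" "finite Jl" "j \<notin> Jl"
    using finJ asym by (auto simp: Jl_def)
  have Jl_before: "b \<in> J" "j \<noteq> b" "\<not> prec j b" if "b \<in> Jl" for b
    using that asym[of j b] Jl by (auto simp: Jl_def)
  have U_before: "U j b = 0" and C_before: "C j b = 0" if "b \<in> Jl" for b
    using Jl_before[OF that] by (simp_all add: Utri[OF j] Ctri[OF j])
  define y where "y a = (\<Sum>b\<in>J. U a b * u b)" for a
  define e where "e a = (\<Sum>b\<in>J. C a b * u b)" for a
  define E where "E = (\<Sum>a\<in>J' - J. (cmod (e a))\<^sup>2)"
  define Y where "Y = (\<Sum>a\<in>Jl. (cmod (y a))\<^sup>2)"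
  have E0: "E \<ge> 0" and Y0: "Y \<ge> 0"
    by (simp_all add: E_def Y_def sum_nonneg)
  have e_eq: "e a = (if a = j then 1 else 0)" if "a \<in> J" for a
    using Cu[OF that] by (simp add: e_def)
  have ysupp: "y a = 0" if "a \<in> J" "a \<noteq> j" "\<not> prec a j" for a
    unfolding y_def
  proof (intro sum.neutral ballI)
    fix b assume "b \<in> J"
    show "U a b * u b = 0"
      by (cases "b = j \<or> prec b j") (use that \<open>b \<in> J\<close> Utri usupp ord in \<open>auto dest: transpD\<close>)
  qed
  have splitJ: "sum f J = f j + sum f Jl" if "\<And>a. a \<in> J \<Longrightarrow> a \<noteq> j \<Longrightarrow> \<not> prec a j \<Longrightarrow> f a = 0"
    for f :: "'k \<Rightarrow> 'b::comm_monoid_add"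
  proof -
    have "sum f J = sum f (insert j Jl)"
      by (rule sum.mono_neutral_right) (use finJ j that in \<open>auto simp: Jl_def\<close>)
    then show ?thesis using Jl by simp
  qed
  have "e j = C j j * u j"
  proof -
    have "(\<Sum>b\<in>J. C j b * u b) = C j j * u j + (\<Sum>b\<in>Jl. C j b * u b)"
      by (rule splitJ) (simp add: usupp)
    also have "(\<Sum>b\<in>Jl. C j b * u b) = 0"
      by (simp add: C_before)
    finally show ?thesis by (simp add: e_def)
  qed
  then have Cju: "C j j * u j = 1"
    using e_eq j by simp
  define t where "t = Re (C j j)"
  have t: "t > 0" "C j j = of_real t"
    using Cdiag[OF j] by (auto simp: t_def complex_eq_iff)
  have uj: "u j = of_real (1 / t)"
    using Cju t by (simp add: field_simps)
  have "y j = U j j * u j"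
  proof -
    have "y j = U j j * u j + (\<Sum>b\<in>Jl. U j b * u b)"
      unfolding y_def by (rule splitJ) (simp add: usupp)
    also have "(\<Sum>b\<in>Jl. U j b * u b) = 0"
      by (simp add: U_before)
    finally show ?thesis by simp
  qed
  moreover define s where "s = Re (U j j) / t"
  ultimately have yj: "y j = of_real s" and s: "s > 0"
    using Udiag[OF j] t(1) uj by (auto simp: complex_eq_iff)
  have norm_y: "s\<^sup>2 + Y = 1 + E"
  proof -
    have "of_real (\<Sum>k\<in>J. (cmod (y k))\<^sup>2) = (of_real (\<Sum>k\<in>J'. (cmod (e k))\<^sup>2) :: complex)"
      unfolding sum_cnj_mult_self[symmetric] y_def e_def by (rule gram_form[OF gram])
    then have "(\<Sum>k\<in>J. (cmod (y k))\<^sup>2) = (\<Sum>k\<in>J'. (cmod (e k))\<^sup>2)"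
      by (simp only: of_real_eq_iff)
    also have "\<dots> = E + (\<Sum>k\<in>J. (cmod (e k))\<^sup>2)"
      unfolding E_def by (rule sum.subset_diff[OF \<open>J \<subseteq> J'\<close> fin])
    also have "(\<Sum>k\<in>J. (cmod (e k))\<^sup>2) = (\<Sum>k\<in>J. if k = j then 1 else 0)"
      by (intro sum.cong refl) (simp add: e_eq)
    also have "\<dots> = 1" using finJ j by simp
    also have "(\<Sum>k\<in>J. (cmod (y k))\<^sup>2) = s\<^sup>2 + Y"
      unfolding Y_def by (subst splitJ) (auto simp: ysupp yj)
    finally show ?thesis by simp
  qed
  have "Y \<le> E"
  proof -
    have "\<exists>x. \<forall>a\<in>Jl. (\<Sum>b\<in>Jl. U a b * x b) = y a"
    proof (rule triangular_solvable[OF Jl(2) ord])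
      show "U a a \<noteq> 0" if "a \<in> Jl" for a
        using Udiag[of a] that Jl by (auto simp: complex_eq_iff)
    qed (use Utri Jl in auto)
    then obtain x0 where x0: "\<And>a. a \<in> Jl \<Longrightarrow> (\<Sum>b\<in>Jl. U a b * x0 b) = y a" by blast
    define x where "x b = (if b \<in> Jl then x0 b else 0)" for b
    have restr: "(\<Sum>b\<in>J. M b * x b) = (\<Sum>b\<in>Jl. M b * x0 b)" for M
      unfolding x_def by (rule sum.mono_neutral_cong_right) (use finJ Jl in auto)
    define v where "v a = (\<Sum>b\<in>J. U a b * x b)" for a
    define d where "d a = (\<Sum>b\<in>J. C a b * x b)" for a
    have v: "v a = (if a \<in> Jl then y a else 0)" if "a \<in> J" for a
    proof (cases "a \<in> Jl")
      case False
      have "U a b * x0 b = 0" if "b \<in> Jl" for b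
        using that False \<open>a \<in> J\<close> Utri[of a b] ord(1) unfolding Jl_def
        by (auto dest: transpD)
      then have "(\<Sum>b\<in>Jl. U a b * x0 b) = 0"
        by (rule sum.neutral[OF ballI])
      then show ?thesis using False by (simp add: v_def restr)
    qed (simp add: v_def restr x0)
    have dj: "d j = 0"
      unfolding d_def restr by (simp add: C_before)
    have vv: "(\<Sum>k\<in>J. (cmod (v k))\<^sup>2) = Y"
      unfolding Y_def by (rule sum.mono_neutral_cong_right) (use finJ Jl v in auto)
    have "(\<Sum>k\<in>J. cnj (v k) * y k) = (\<Sum>k\<in>Jl. cnj (y k) * y k)"
      by (rule sum.mono_neutral_cong_right) (use finJ Jl v in auto)
    then have vy: "(\<Sum>k\<in>J. cnj (v k) * y k) = of_real Y"
      by (simp only: sum_cnj_mult_self Y_def)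
    have "(\<Sum>k\<in>J. cnj (v k) * y k) = (\<Sum>k\<in>J'. cnj (d k) * e k)"
      unfolding v_def y_def d_def e_def by (rule gram_form[OF gram])
    also have "\<dots> = (\<Sum>k\<in>J' - J. cnj (d k) * e k) + (\<Sum>k\<in>J. cnj (d k) * e k)"
      by (rule sum.subset_diff[OF \<open>J \<subseteq> J'\<close> fin])
    also have "(\<Sum>k\<in>J. cnj (d k) * e k) = 0"
      by (intro sum.neutral) (auto simp: e_eq dj)
    finally have de: "of_real Y = (\<Sum>k\<in>J' - J. cnj (d k) * e k)"
      using vy by simp
    have "of_real (\<Sum>k\<in>J. (cmod (v k))\<^sup>2) = (of_real (\<Sum>k\<in>J'. (cmod (d k))\<^sup>2) :: complex)"
      unfolding sum_cnj_mult_self[symmetric] v_def d_def by (rule gram_form[OF gram])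
    then have dd: "(\<Sum>k\<in>J'. (cmod (d k))\<^sup>2) = Y"
      by (simp only: of_real_eq_iff vv)
    have "Y\<^sup>2 = (cmod (\<Sum>k\<in>J' - J. cnj (d k) * e k))\<^sup>2"
      unfolding de[symmetric] by simp
    also have "\<dots> \<le> (\<Sum>k\<in>J' - J. (cmod (d k))\<^sup>2) * E"
      unfolding E_def by (rule cmod_sum_cnj_mult_squared_le)
    also have "\<dots> \<le> Y * E"
      unfolding dd[symmetric] by (intro mult_right_mono sum_mono2 E0) (use fin in auto)
    finally show ?thesis
      using E0 Y0 by (cases "Y = 0") (auto simp: power2_eq_square)
  qed
  have "1 \<le> s"
    by (rule power2_le_imp_le) (use norm_y \<open>Y \<le> E\<close> s in auto)
  then have "(s - 1)\<^sup>2 \<le> s\<^sup>2 - 1"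
    by (simp add: power2_eq_square algebra_simps)
  have "(\<Sum>a\<in>J. (cmod (y a - (if a = j then 1 else 0)))\<^sup>2) = (cmod (y j - 1))\<^sup>2 + Y"
    unfolding Y_def by (subst splitJ) (use Jl in \<open>auto simp: ysupp intro!: sum.cong\<close>)
  also have "cmod (y j - 1) = \<bar>s - 1\<bar>"
    unfolding yj by (metis norm_of_real of_real_1 of_real_diff real_norm_def)
  also have "\<bar>s - 1\<bar>\<^sup>2 + Y \<le> 2 * E"
    using \<open>(s - 1)\<^sup>2 \<le> s\<^sup>2 - 1\<close> norm_y E0 by simp
  finally show "(\<Sum>a\<in>J. (cmod ((\<Sum>b\<in>J. U a b * u b) - (if a = j then 1 else 0)))\<^sup>2) \<le>
      2 * (\<Sum>a\<in>J' - J. (cmod (\<Sum>b\<in>J. C a b * u b))\<^sup>2)"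
    unfolding y_def e_def E_def .
qed

subsection \<open>Inverses of matrix polynomials\<close>

lemma ball_superset_unit_disc:
  fixes S :: "complex set"
  assumes "open S" "cball 0 1 \<subseteq> S"
  obtains R where "R > 1" "ball 0 R \<subseteq> S"
proof -
  obtain e where e: "e > 0" "(\<Union>x\<in>cball 0 1. ball x e) \<subseteq> S"
    using compact_subset_open_imp_ball_epsilon_subset[OF compact_cball assms] by blast
  have "w \<in> S" if "cmod w < 1 + e" for w
  proof (cases "cmod w \<le> 1")
    case False
    have "w \<noteq> 0"
      using False by (metis norm_zero zero_le_one)
    then have "w - sgn w = of_real (cmod w - 1) * sgn w"
      by (simp add: sgn_eq field_simps)
    then have "dist (sgn w) w = cmod (of_real (cmod w - 1) * sgn w)"
      by (simp only: dist_norm norm_minus_commute[of "sgn w"])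
    also have "\<dots> = cmod w - 1"
      using False \<open>w \<noteq> 0\<close> by (simp add: norm_mult norm_sgn del: of_real_diff)
    finally have "w \<in> ball (sgn w) e"
      using that by simp
    moreover have "sgn w \<in> cball 0 1"
      by (simp add: norm_sgn)
    ultimately show ?thesis using e(2) by blast
  qed (use assms in auto)
  then show ?thesis
    using e(1) by (intro that[of "1 + e"]) auto
qed

lemma fps_nth_bounded_of_conv_radius:
  fixes F :: "complex fps"
  assumes "0 < t" "ereal t < fps_conv_radius F"
  shows "\<exists>K\<ge>0. \<forall>k. cmod (fps_nth F k) \<le> K * (1 / t) ^ k"
proof -
  have "summable (\<lambda>k. fps_nth F k * of_real t ^ k)"
    using assms by (intro summable_fps) auto
  then have "Bseq (\<lambda>k. fps_nth F k * of_real t ^ k)"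
    by (rule summable_imp_Bseq)
  then obtain K where K: "K > 0" "\<And>k. cmod (fps_nth F k * of_real t ^ k) \<le> K"
    by (auto elim: BseqE)
  have "cmod (fps_nth F k) \<le> K * (1 / t) ^ k" for k
    using K(2)[of k] assms(1) by (simp add: norm_mult norm_power power_divide field_simps)
  then show ?thesis using K(1) by (intro exI[of _ K]) auto
qed

lemma holomorphic_on_det:
  fixes M :: "complex \<Rightarrow> complex ^ 'n::finite ^ 'n"
  assumes "\<And>r s. (\<lambda>w. M w $ r $ s) holomorphic_on S"
  shows "(\<lambda>w. det (M w)) holomorphic_on S"
  unfolding det_def using assms by (intro holomorphic_intros)

lemma matrix_polynomial_inverse_coefficients:
  fixes a :: "nat \<Rightarrow> 'm::finite cblock" and b :: nat
  assumes deg: "\<And>k. k > b \<Longrightarrow> a k = 0"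
    and nz: "\<And>w. cmod w \<le> 1 \<Longrightarrow> det (\<chi> r s. \<Sum>l\<le>b. a l $ r $ s * w ^ l) \<noteq> 0"
  obtains D :: "nat \<Rightarrow> 'm cblock" and K \<rho> :: real
  where "0 \<le> K" "0 < \<rho>" "\<rho> < 1" "\<And>k r s. cmod (D k $ r $ s) \<le> K * \<rho> ^ k"
    and "\<And>k. (\<Sum>l\<le>k. a l ** D (k - l)) = (if k = 0 then mat 1 else 0)"
    and "\<And>k. (\<Sum>l\<le>k. D l ** a (k - l)) = (if k = 0 then mat 1 else 0)"
proof -
  define A :: "complex \<Rightarrow> 'm cblock" where "A w = (\<chi> r s. \<Sum>l\<le>b. a l $ r $ s * w ^ l)" for w
  have hA: "(\<lambda>w. A w $ r $ s) holomorphic_on S" for r s S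
    by (auto simp: A_def intro!: holomorphic_intros)
  have "continuous_on UNIV (\<lambda>w. det (A w))"
    by (intro holomorphic_on_imp_continuous_on holomorphic_on_det hA)
  then have "open ((\<lambda>w. det (A w)) -` (- {0}))"
    by (intro open_vimage) auto
  moreover have "cball 0 1 \<subseteq> (\<lambda>w. det (A w)) -` (- {0})"
    using nz by (auto simp: A_def)
  ultimately obtain R where R: "R > 1" "ball 0 R \<subseteq> (\<lambda>w. det (A w)) -` (- {0})"
    by (rule ball_superset_unit_disc)
  have detA: "det (A w) \<noteq> 0" if "w \<in> ball 0 R" for w
    using R(2) that by auto
  define X :: "complex \<Rightarrow> 'm cblock" where
    "X w = (\<chi> k s. det (\<chi> i j. if j = k then axis s 1 $ i else A w $ i $ j) / det (A w))" for w
  have AX: "A w ** X w = mat 1" if "w \<in> ball 0 R" for w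
  proof -
    have "A w *v column s (X w) = axis s 1" for s
      by (subst cramer[OF detA[OF that]]) (simp add: column_def X_def)
    then have "column s (A w ** X w) = axis s 1" for s
      by (simp add: column_def matrix_matrix_mult_def matrix_vector_mult_def)
    then show ?thesis
      by (auto simp: vec_eq_iff column_def mat_def axis_def)
  qed
  then have XA: "X w ** A w = mat 1" if "w \<in> ball 0 R" for w
    using that by (simp add: matrix_left_right_inverse)
  have hX: "(\<lambda>w. X w $ r $ s) holomorphic_on ball 0 R" for r s
    unfolding X_def vec_lambda_beta
  proof (intro holomorphic_on_divide holomorphic_on_det hA)
    fix i j
    show "(\<lambda>w. (\<chi> i j. if j = r then axis s 1 $ i else A w $ i $ j) $ i $ j) holomorphic_on ball 0 R"
      by (cases "j = r") (auto intro: hA holomorphic_intros)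
  qed (use detA in auto)
  define FX where "FX r s = fps_expansion (\<lambda>w. X w $ r $ s) 0" for r s
  define FA where "FA r s = Abs_fps (\<lambda>l. a l $ r $ s)" for r s
  have FX: "(\<lambda>w. X w $ r $ s) has_fps_expansion FX r s" for r s
    unfolding FX_def using R(1) by (intro has_fps_expansion_fps_expansion[OF open_ball _ hX]) auto
  have FA: "(\<lambda>w. A w $ r $ s) has_fps_expansion FA r s" for r s
  proof -
    have "(\<lambda>w. \<Sum>l\<le>b. a l $ r $ s * w ^ l) has_fps_expansion
        (\<Sum>l\<le>b. fps_const (a l $ r $ s) * fps_X ^ l)"
      by (intro fps_expansion_intros)
    also have "(\<Sum>l\<le>b. fps_const (a l $ r $ s) * fps_X ^ l) = FA r s"
      unfolding FA_def fps_eq_iff using deg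
      by (auto simp: fps_sum_nth if_distrib cong: if_cong)
    finally show ?thesis by (simp add: A_def)
  qed
  have near: "\<forall>\<^sub>F w in nhds 0. w \<in> ball 0 R"
    using R(1) by (intro eventually_nhds_in_open) auto
  have inverse_fps: "(\<Sum>q\<in>UNIV. G r q * H q s) = fps_const (mat 1 $ r $ s)"
    if "\<And>r s. (\<lambda>w. Y w $ r $ s) has_fps_expansion G r s"
      and "\<And>r s. (\<lambda>w. Z w $ r $ s) has_fps_expansion H r s"
      and YZ: "\<And>w. w \<in> ball 0 R \<Longrightarrow> Y w ** Z w = mat 1"
    for Y Z :: "complex \<Rightarrow> 'm cblock" and G H :: "'m \<Rightarrow> 'm \<Rightarrow> complex fps" and r s
  proof -
    have exp: "(\<lambda>w. \<Sum>q\<in>UNIV. Y w $ r $ q * Z w $ q $ s) has_fps_expansion (\<Sum>q\<in>UNIV. G r q * H q s)"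
      by (intro fps_expansion_intros that)
    have "\<forall>\<^sub>F w in nhds 0. (\<Sum>q\<in>UNIV. Y w $ r $ q * Z w $ q $ s) = mat 1 $ r $ s"
      using near
    proof eventually_elim
      case (elim w)
      have "(Y w ** Z w) $ r $ s = mat 1 $ r $ s"
        using YZ[OF elim] by simp
      then show ?case by (simp add: matrix_matrix_mult_def)
    qed
    then have "(\<lambda>w. mat 1 $ r $ s) has_fps_expansion (\<Sum>q\<in>UNIV. G r q * H q s)"
      using exp by (rule has_fps_expansion_cong[OF _ refl, THEN iffD1])
    then show ?thesis
      using fps_expansion_unique_complex has_fps_expansion_const by blast
  qed
  have conv: "(\<Sum>l\<le>k. g l ** h (k - l)) = (if k = 0 then mat 1 else 0)"
    if GH: "\<And>r s. (\<Sum>q\<in>UNIV. Abs_fps (\<lambda>l. g l $ r $ q) * Abs_fps (\<lambda>l. h l $ q $ s)) =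
      fps_const (mat 1 $ r $ s)"
    for g h :: "nat \<Rightarrow> 'm cblock" and k
  proof -
    have "(\<Sum>l\<le>k. g l ** h (k - l)) $ r $ s = (if k = 0 then mat 1 else 0) $ r $ s" for r s
    proof -
      have "(\<Sum>l\<le>k. g l ** h (k - l)) $ r $ s = (\<Sum>l\<le>k. \<Sum>q\<in>UNIV. g l $ r $ q * h (k - l) $ q $ s)"
        by (simp add: matrix_matrix_mult_def)
      also have "\<dots> = (\<Sum>q\<in>UNIV. \<Sum>l\<le>k. g l $ r $ q * h (k - l) $ q $ s)"
        by (rule sum.swap)
      also have "\<dots> = fps_nth (\<Sum>q\<in>UNIV. Abs_fps (\<lambda>l. g l $ r $ q) * Abs_fps (\<lambda>l. h l $ q $ s)) k"
        by (simp add: fps_sum_nth fps_mult_nth atLeast0AtMost)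
      finally show ?thesis by (simp add: GH)
    qed
    then show ?thesis by (simp add: vec_eq_iff)
  qed
  define D :: "nat \<Rightarrow> 'm cblock" where "D k = (\<chi> r s. fps_nth (FX r s) k)" for k
  have FX_D: "Abs_fps (\<lambda>l. D l $ r $ s) = FX r s" for r s
    by (simp add: D_def fps_eq_iff)
  define t where "t = (1 + R) / 2"
  have t: "1 < t" "t < R"
    using R(1) by (auto simp: t_def)
  have "\<exists>K\<ge>0. \<forall>k. cmod (fps_nth (FX r s) k) \<le> K * (1 / t) ^ k" for r s
  proof (rule fps_nth_bounded_of_conv_radius)
    have "ereal t < ereal R" using t by simp
    also have "\<dots> \<le> fps_conv_radius (FX r s)"
      unfolding FX_def by (intro conv_radius_fps_expansion) (simp add: hX)
    finally show "ereal t < fps_conv_radius (FX r s)" .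
  qed (use t in auto)
  then obtain K where K: "\<And>r s. K r s \<ge> 0" "\<And>r s k. cmod (fps_nth (FX r s) k) \<le> K r s * (1 / t) ^ k"
    by metis
  define K' where "K' = (\<Sum>r\<in>UNIV. \<Sum>s\<in>UNIV. K r s)"
  have KK': "K r s \<le> K'" for r s
  proof -
    have "K r s \<le> (\<Sum>s\<in>UNIV. K r s)"
      by (rule member_le_sum) (auto intro: K)
    also have "\<dots> \<le> K'"
      unfolding K'_def by (rule member_le_sum) (auto intro!: K sum_nonneg)
    finally show ?thesis .
  qed
  show ?thesis
  proof (rule that[of K' "1 / t" D])
    show "cmod (D k $ r $ s) \<le> K' * (1 / t) ^ k" for k r s
    proof -
      have "cmod (D k $ r $ s) \<le> K r s * (1 / t) ^ k"
        by (simp add: D_def K(2) del: power_one_over)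
      also have "\<dots> \<le> K' * (1 / t) ^ k"
        using t by (intro mult_right_mono KK') auto
      finally show ?thesis .
    qed
    show "(\<Sum>l\<le>k. a l ** D (k - l)) = (if k = 0 then mat 1 else 0)" for k
      by (rule conv) (unfold FX_D FA_def[symmetric], rule inverse_fps[OF FA FX AX])
    show "(\<Sum>l\<le>k. D l ** a (k - l)) = (if k = 0 then mat 1 else 0)" for k
      by (rule conv) (unfold FX_D FA_def[symmetric], rule inverse_fps[OF FX FA XA])
    show "0 \<le> K'"
      unfolding K'_def by (intro sum_nonneg K)
  qed (use t in auto)
qed

subsection \<open>Block Toeplitz factors and their sections\<close>

lemma cadjoint_0 [simp]: "cadjoint 0 = 0"
  by (simp add: cadjoint_def vec_eq_iff)

lemma zero_block_mult:
  fixes A :: "'m::finite cblock"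
  shows "0 ** A = 0" "A ** 0 = 0"
  by (simp_all add: matrix_matrix_mult_def vec_eq_iff)

lemma sum_matrix_vector_mult:
  fixes A :: "'i \<Rightarrow> complex ^ 'm::finite ^ 'k::finite"
  shows "(\<Sum>i\<in>S. A i) *v v = (\<Sum>i\<in>S. A i *v v)"
  by (induction S rule: infinite_finite_induct) (auto simp: matrix_vector_mult_add_rdistrib)

lemma matrix_vector_mult_sum:
  fixes A :: "complex ^ 'm::finite ^ 'k::finite"
  shows "A *v (\<Sum>i\<in>S. v i) = (\<Sum>i\<in>S. A *v v i)"
  by (induction S rule: infinite_finite_induct) (auto simp: matrix_vector_right_distrib)

lemma matrix_vector_mult_smult:
  fixes A :: "complex ^ 'm::finite ^ 'k::finite"
  shows "A *v (x *s v) = x *s (A *v v)"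
  by (simp add: vec_eq_iff matrix_vector_mult_def sum_distrib_left mult_ac)

lemma smult_sum:
  fixes v :: "'i \<Rightarrow> complex ^ 'm::finite"
  shows "x *s (\<Sum>i\<in>S. v i) = (\<Sum>i\<in>S. x *s v i)"
  by (simp add: vec_eq_iff sum_distrib_left)

lemma laurent_mult_vector:
  "laurent n p z *v v = (\<Sum>k = - int n..int n. z powi k *s (p k *v v))"
proof -
  have "(\<Sum>s\<in>UNIV. (\<Sum>k = - int n..int n. p k $ r $ s * z powi k) * v $ s) =
      (\<Sum>k = - int n..int n. z powi k * (\<Sum>s\<in>UNIV. p k $ r $ s * v $ s))" for r
    unfolding sum_distrib_left sum_distrib_right
    by (subst sum.swap) (intro sum.cong refl, simp add: mult_ac)
  then show ?thesis
    by (simp add: vec_eq_iff laurent_def matrix_vector_mult_def)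
qed

lemma det_triangular_nonzero:
  fixes A :: "'m::{finite,linorder} cblock"
  assumes tri: "\<And>r s. s < r \<Longrightarrow> A $ r $ s = 0" and diag: "\<And>r. A $ r $ r \<noteq> 0"
  shows "det A \<noteq> 0"
proof -
  have "\<exists>x. A *v x = y" for y
  proof -
    have "\<exists>x. \<forall>r\<in>UNIV. (\<Sum>s\<in>UNIV. A $ r $ s * x s) = y $ r"
    proof (rule triangular_solvable[of _ "(<)"])
      show "A $ r $ s = 0" if "r \<noteq> s" "\<not> r < s" for r s
        using tri[of s r] that by simp
    qed (use diag in \<open>auto simp: irreflp_def\<close>)
    then obtain x where "\<And>r. (\<Sum>s\<in>UNIV. A $ r $ s * x s) = y $ r" by blast
    then have "A *v (\<chi> s. x s) = y"
      by (simp add: vec_eq_iff matrix_vector_mult_def)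
    then show ?thesis ..
  qed
  then have "surj ((*v) A)"
    by (metis surjI)
  then have "invertible A"
    using matrix_right_invertible_surjective[of A] invertible_right_inverse[of A] by blast
  then show ?thesis
    by (simp add: invertible_det_nz)
qed

definition block_prec :: "int \<times> 'm::linorder \<Rightarrow> int \<times> 'm \<Rightarrow> bool" where
  "block_prec a b \<longleftrightarrow> fst a < fst b \<or> fst a = fst b \<and> snd a < snd b"

lemma transp_block_prec: "transp block_prec"
  by (rule transpI) (auto simp: block_prec_def)

lemma irreflp_block_prec: "irreflp block_prec"
  by (auto simp: irreflp_def block_prec_def)

definition scalar_entry :: "'m::finite bmatrix \<Rightarrow> int \<times> 'm \<Rightarrow> int \<times> 'm \<Rightarrow> complex" where
  "scalar_entry A a b = A (fst a) (fst b) $ snd a $ snd b"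

lemma scalar_entry_mult:
  "(\<Sum>k\<in>S. A i k ** B k j) $ r $ s =
    (\<Sum>k\<in>S \<times> UNIV. scalar_entry A (i, r) k * scalar_entry B k (j, s))"
  by (simp add: scalar_entry_def matrix_matrix_mult_def sum.cartesian_product' case_prod_unfold)

lemma scalar_entry_gram:
  "(\<Sum>k\<in>S. cadjoint (A k i) ** A k j) $ r $ s =
    (\<Sum>k\<in>S \<times> UNIV. cnj (scalar_entry A k (i, r)) * scalar_entry A k (j, s))"
  by (simp add: scalar_entry_def matrix_matrix_mult_def cadjoint_def sum.cartesian_product' case_prod_unfold)

lemma upper_triangular_scalar_entry:
  assumes "upper_triangular_on I A" "fst a \<in> I" "fst b \<in> I" "a \<noteq> b" "\<not> block_prec a b"
  shows "scalar_entry A a b = 0"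
proof -
  have "fst b < fst a \<or> fst a = fst b \<and> snd b < snd a"
    using assms(4,5) by (auto simp: block_prec_def prod_eq_iff)
  then show ?thesis
    using assms(1-3) by (auto simp: upper_triangular_on_def scalar_entry_def)
qed

lemma bmatrix_apply_nth:
  assumes "finite S" "\<And>i. i \<notin> S \<Longrightarrow> \<delta> i = 0"
  shows "bmatrix_apply A \<delta> i $ r =
    (\<Sum>k\<in>S \<times> UNIV. scalar_entry A (i, r) k * \<delta> (fst k) $ snd k)"
proof -
  have "(\<Sum>\<^sub>\<infinity>j. A i j *v \<delta> j) = (\<Sum>\<^sub>\<infinity>j\<in>S. A i j *v \<delta> j)"
    by (rule infsum_cong_neutral) (use assms in auto)
  also have "\<dots> = (\<Sum>j\<in>S. A i j *v \<delta> j)"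
    using assms by simp
  finally show ?thesis
    by (simp add: bmatrix_apply_def scalar_entry_def matrix_vector_mult_def
        sum.cartesian_product' case_prod_unfold)
qed

lemma ell2_norm_nonneg: "0 \<le> ell2_norm x"
  by (simp add: ell2_norm_def infsum_nonneg)

lemma ell2_norm_finite_support:
  assumes "finite S" "\<And>i. i \<notin> S \<Longrightarrow> x i = 0"
  shows "(ell2_norm x)\<^sup>2 = (\<Sum>k\<in>S \<times> UNIV. (cmod (x (fst k) $ snd k))\<^sup>2)"
proof -
  have "(ell2_norm x)\<^sup>2 = (\<Sum>\<^sub>\<infinity>i. (norm (x i))\<^sup>2)"
    by (simp add: ell2_norm_def infsum_nonneg)
  also have "\<dots> = (\<Sum>\<^sub>\<infinity>i\<in>S. (norm (x i))\<^sup>2)"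
    by (rule infsum_cong_neutral) (use assms in auto)
  also have "\<dots> = (\<Sum>i\<in>S. \<Sum>r\<in>UNIV. (cmod (x i $ r))\<^sup>2)"
    using assms(1) by (simp add: norm_vec_def L2_set_def sum_nonneg)
  finally show ?thesis
    by (simp add: sum.cartesian_product' case_prod_unfold)
qed

lemma geometric_bound_of_eventual:
  fixes f :: "nat \<Rightarrow> real"
  assumes "0 < \<rho>" "\<And>N. 0 \<le> f N" and bound: "\<And>N. L \<le> N \<Longrightarrow> f N \<le> G * \<rho> ^ (N - L)"
  shows "\<exists>K>0. \<forall>N. f N < K * \<rho> ^ N"
proof -
  define S where "S = (\<Sum>N<L. f N / \<rho> ^ N)"
  define K where "K = \<bar>G\<bar> / \<rho> ^ L + S"
  have S0: "0 \<le> S"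
    unfolding S_def using assms by (intro sum_nonneg) auto
  have "f N \<le> K * \<rho> ^ N" for N
  proof (cases "N < L")
    case True
    have "f N / \<rho> ^ N \<le> S"
      unfolding S_def
      by (rule member_le_sum[of N _ "\<lambda>N. f N / \<rho> ^ N"]) (use True assms in auto)
    also have "\<dots> \<le> K"
      using \<open>0 < \<rho>\<close> by (simp add: K_def)
    finally show ?thesis
      using \<open>0 < \<rho>\<close> by (simp add: pos_divide_le_eq)
  next
    case False
    then have "f N \<le> G * \<rho> ^ (N - L)"
      by (intro bound) simp
    also have "\<dots> \<le> \<bar>G\<bar> * \<rho> ^ (N - L)"
      using \<open>0 < \<rho>\<close> by (intro mult_right_mono) auto
    also have "\<dots> = \<bar>G\<bar> / \<rho> ^ L * \<rho> ^ N"
      using False \<open>0 < \<rho>\<close> by (simp add: power_diff)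
    also have "\<dots> \<le> K * \<rho> ^ N"
      unfolding K_def using S0 \<open>0 < \<rho>\<close> by (intro mult_right_mono) auto
    finally show ?thesis .
  qed
  then have "f N < (K + 1) * \<rho> ^ N" for N
    by (rule le_less_trans[of _ "K * \<rho> ^ N"]) (use \<open>0 < \<rho>\<close> in simp_all)
  moreover have "K \<ge> 0"
    using S0 \<open>0 < \<rho>\<close> by (simp add: K_def)
  ultimately show ?thesis
    by (intro exI[of _ "K + 1"]) auto
qed

definition toeplitz_factor ::
  "nat \<Rightarrow> (int \<Rightarrow> 'm::{finite,linorder} cblock) \<Rightarrow> (int \<Rightarrow> 'm cblock) \<Rightarrow> bool" where
  "toeplitz_factor b p c \<longleftrightarrow>
    banded b (toeplitz c) \<and> cholesky_on UNIV (toeplitz p) (toeplitz c)"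

lemma symbol_support:
  assumes F: "toeplitz_factor b p c" and "k \<notin> {- int b..0}"
  shows "c k = 0"
proof (cases "k > 0")
  case True
  then show ?thesis
    using F unfolding toeplitz_factor_def cholesky_on_def upper_triangular_on_def toeplitz_def
    by (metis UNIV_I diff_zero)
next
  case False
  then have "\<bar>k - 0\<bar> > int b" using assms by auto
  then show ?thesis
    using F unfolding toeplitz_factor_def banded_def toeplitz_def by (metis diff_zero)
qed

lemma symbol_0_triangular: "toeplitz_factor b p c \<Longrightarrow> s < r \<Longrightarrow> c 0 $ r $ s = 0"
  unfolding toeplitz_factor_def cholesky_on_def upper_triangular_on_def toeplitz_def by auto

lemma symbol_0_diagonal:
  "toeplitz_factor b p c \<Longrightarrow> Im (c 0 $ r $ r) = 0 \<and> 0 < Re (c 0 $ r $ r)"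
  unfolding toeplitz_factor_def cholesky_on_def positive_diagonal_on_def toeplitz_def by auto

lemma product_entry:
  assumes F: "toeplitz_factor b p c"
    and S: "finite S" "\<And>k. k \<notin> S \<Longrightarrow> k < j - int b \<or> i < k \<or> j < k"
  shows "p (i - j) = (\<Sum>k\<in>S. cadjoint (c (k - i)) ** c (k - j))"
proof -
  have "p (i - j) = (\<Sum>\<^sub>\<infinity>k. cadjoint (c (k - i)) ** c (k - j))"
    using F by (simp add: toeplitz_factor_def cholesky_on_def toeplitz_def)
  also have "\<dots> = (\<Sum>\<^sub>\<infinity>k\<in>S. cadjoint (c (k - i)) ** c (k - j))"
  proof (rule infsum_cong_neutral)
    show "cadjoint (c (k - i)) ** c (k - j) = 0" if "k \<in> UNIV - S" for k
    proof -
      have "c (k - i) = 0 \<or> c (k - j) = 0"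
        using S(2)[of k] that symbol_support[OF F, of "k - i"] symbol_support[OF F, of "k - j"]
        by auto
      then show ?thesis by (auto simp: zero_block_mult)
    qed
  qed auto
  finally show ?thesis using S(1) by simp
qed

text \<open>\<open>P(z) v = C(z)\<^sup>\<dagger> C(z) v\<close> on the unit circle, so a kernel vector of \<open>C(z)\<close> is also one of \<open>P(z)\<close>.\<close>

lemma det_symbol_nonzero_circle:
  fixes p c :: "int \<Rightarrow> 'm::{finite,linorder} cblock"
  assumes F: "toeplitz_factor b p c" and p: "\<And>k. \<bar>k\<bar> > int n \<Longrightarrow> p k = 0"
    and "z \<noteq> 0" and pd: "positive_definite (laurent n p z)"
  shows "det (laurent b c z) \<noteq> 0"
proof
  note symbol_support = symbol_support[OF F] and product_entry = product_entry[OF F]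
  assume "det (laurent b c z) = 0"
  then have "\<not> (\<exists>B. B ** laurent b c z = mat 1)"
    using invertible_det_nz[of "laurent b c z"] invertible_left_inverse[of "laurent b c z"] by blast
  then obtain v where v: "laurent b c z *v v = 0" "v \<noteq> 0"
    unfolding matrix_left_invertible_ker by blast
  define J where "J = {- int b..0}"
  have Cv: "(\<Sum>j\<in>J. z powi j *s (c j *v v)) = 0"
  proof -
    have "(\<Sum>j\<in>J. z powi j *s (c j *v v)) = laurent b c z *v v"
      unfolding laurent_mult_vector J_def
      by (rule sum.mono_neutral_left) (auto simp: symbol_support)
    then show ?thesis using v by simp
  qed
  define M where "M = int n + int b"
  have "laurent n p z *v v = (\<Sum>k = - M..M. z powi k *s (p k *v v))"
    unfolding laurent_mult_vector
    by (rule sum.mono_neutral_left) (auto simp: M_def p)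
  also have "\<dots> = (\<Sum>k = - M..M. \<Sum>j\<in>J. z powi k *s (cadjoint (c (j - k)) *v (c j *v v)))"
  proof (intro sum.cong refl)
    fix k
    have "p (k - 0) = (\<Sum>j\<in>J. cadjoint (c (j - k)) ** c (j - 0))"
      by (rule product_entry) (auto simp: J_def)
    then show "z powi k *s (p k *v v) = (\<Sum>j\<in>J. z powi k *s (cadjoint (c (j - k)) *v (c j *v v)))"
      by (simp add: sum_matrix_vector_mult smult_sum matrix_vector_mul_assoc)
  qed
  also have "\<dots> = (\<Sum>j\<in>J. \<Sum>k = - M..M. z powi k *s (cadjoint (c (j - k)) *v (c j *v v)))"
    by (rule sum.swap)
  also have "\<dots> = (\<Sum>j\<in>J. \<Sum>l\<in>J. z powi (- l) *s (cadjoint (c l) *v (z powi j *s (c j *v v))))"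
  proof (rule sum.cong[OF refl])
    fix j assume "j \<in> J"
    have "(\<Sum>k = - M..M. z powi k *s (cadjoint (c (j - k)) *v (c j *v v))) =
        (\<Sum>k = j..j + int b. z powi k *s (cadjoint (c (j - k)) *v (c j *v v)))"
      by (rule sum.mono_neutral_right) (use \<open>j \<in> J\<close> in \<open>auto simp: M_def J_def symbol_support\<close>)
    also have "\<dots> = (\<Sum>l\<in>J. z powi (j - l) *s (cadjoint (c l) *v (c j *v v)))"
      by (rule sum.reindex_bij_witness[of _ "\<lambda>l. j - l" "\<lambda>k. j - k"]) (auto simp: J_def)
    also have "\<dots> = (\<Sum>l\<in>J. z powi (- l) *s (cadjoint (c l) *v (z powi j *s (c j *v v))))"
      using \<open>z \<noteq> 0\<close> by (intro sum.cong refl)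
        (simp add: matrix_vector_mult_smult power_int_diff power_int_minus field_simps)
    finally show "(\<Sum>k = - M..M. z powi k *s (cadjoint (c (j - k)) *v (c j *v v))) =
        (\<Sum>l\<in>J. z powi (- l) *s (cadjoint (c l) *v (z powi j *s (c j *v v))))" .
  qed
  also have "\<dots> = (\<Sum>l\<in>J. z powi (- l) *s (cadjoint (c l) *v (\<Sum>j\<in>J. z powi j *s (c j *v v))))"
    unfolding matrix_vector_mult_sum smult_sum by (rule sum.swap)
  also have "\<dots> = 0"
    unfolding Cv by simp
  finally show False
    using pd v(2) unfolding positive_definite_def by fastforce
qed

lemma symbol_inverse:
  fixes p c :: "int \<Rightarrow> 'm::{finite,linorder} cblock"
  assumes F: "toeplitz_factor b p c" and p: "\<And>k. \<bar>k\<bar> > int n \<Longrightarrow> p k = 0"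
    and pd: "\<And>z. cmod z = 1 \<Longrightarrow> positive_definite (laurent n p z)"
    and canonical: "canonical_symbol b c"
  obtains D :: "int \<Rightarrow> 'm cblock" and K \<rho> :: real
  where "0 \<le> K" "0 < \<rho>" "\<rho> < 1" "\<And>k r s. cmod (D k $ r $ s) \<le> K * \<rho> ^ nat k"
    and "\<And>k. k < 0 \<Longrightarrow> D k = 0"
    and "\<And>i k lo hi. i \<in> {lo..hi} \<Longrightarrow> k \<in> {lo..hi} \<Longrightarrow>
      (\<Sum>j = lo..hi. c (i - j) ** D (k - j)) = (if i = k then mat 1 else 0)"
    and "\<And>i k lo hi. i \<in> {lo..hi} \<Longrightarrow> k \<in> {lo..hi} \<Longrightarrow>
      (\<Sum>j = lo..hi. D (j - i) ** c (j - k)) = (if i = k then mat 1 else 0)"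
proof -
  note symbol_support = symbol_support[OF F]
  define a where "a l = c (- int l)" for l
  have deg: "a k = 0" if "k > b" for k
    unfolding a_def using that by (intro symbol_support) auto
  have nz: "det (\<chi> r s. \<Sum>l\<le>b. a l $ r $ s * w ^ l) \<noteq> 0" if "cmod w \<le> 1" for w
  proof (cases "w = 0")
    case True
    have "(\<Sum>l\<le>b. a l $ r $ s * w ^ l) = c 0 $ r $ s" for r s
      by (simp add: True a_def power_0_left if_distrib cong: if_cong)
    then have "(\<chi> r s. \<Sum>l\<le>b. a l $ r $ s * w ^ l) = c 0"
      by (simp add: vec_eq_iff)
    moreover have "det (c 0) \<noteq> 0"
    proof (rule det_triangular_nonzero[OF symbol_0_triangular[OF F]])
      show "c 0 $ r $ r \<noteq> 0" for r
        using symbol_0_diagonal[OF F, of r] by (auto simp: complex_eq_iff)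
    qed
    ultimately show ?thesis by simp
  next
    case False
    have "(\<Sum>k = - int b..int b. c k $ r $ s * (1 / w) powi k) = (\<Sum>l\<le>b. a l $ r $ s * w ^ l)" for r s
    proof -
      have "(\<Sum>k = - int b..int b. c k $ r $ s * (1 / w) powi k) =
          (\<Sum>k = - int b..0. c k $ r $ s * (1 / w) powi k)"
        by (rule sum.mono_neutral_right) (auto simp: symbol_support)
      also have "\<dots> = (\<Sum>l\<le>b. a l $ r $ s * w ^ l)"
        by (rule sum.reindex_bij_witness[of _ "\<lambda>l. - int l" "\<lambda>k. nat (- k)"])
          (use False in \<open>auto simp: a_def power_int_def field_simps\<close>)
      finally show ?thesis .
    qed
    then have "(\<chi> r s. \<Sum>l\<le>b. a l $ r $ s * w ^ l) = laurent b c (1 / w)"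
      by (simp add: laurent_def)
    moreover have "det (laurent b c (1 / w)) \<noteq> 0"
    proof (cases "cmod w = 1")
      case True
      then show ?thesis
        using False by (intro det_symbol_nonzero_circle[OF F p _ pd]) (auto simp: norm_divide)
    next
      case neq: False
      then have "cmod (1 / w) > 1"
        using that False by (simp add: norm_divide)
      then show ?thesis
        using canonical unfolding canonical_symbol_def by blast
    qed
    ultimately show ?thesis by simp
  qed
  obtain E :: "nat \<Rightarrow> 'm cblock" and K \<rho> :: real where K: "0 \<le> K" and \<rho>: "0 < \<rho>" "\<rho> < 1"
    and E: "\<And>k r s. cmod (E k $ r $ s) \<le> K * \<rho> ^ k"
    and aE: "\<And>k. (\<Sum>l\<le>k. a l ** E (k - l)) = (if k = 0 then mat 1 else 0)"
    and Ea: "\<And>k. (\<Sum>l\<le>k. E l ** a (k - l)) = (if k = 0 then mat 1 else 0)"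
    by (rule matrix_polynomial_inverse_coefficients[OF deg nz]) blast+
  define D where "D k = (if k < 0 then 0 else E (nat k))" for k
  have conv: "(\<Sum>j = lo..hi. X (j - i) ** Y (k - j)) = (if i = k then mat 1 else 0)"
    if i: "i \<in> {lo..hi}" and k: "k \<in> {lo..hi}"
      and X: "\<And>k. k < 0 \<Longrightarrow> X k = 0" and Y: "\<And>k. k < 0 \<Longrightarrow> Y k = 0"
      and XY: "\<And>k. (\<Sum>l\<le>k. X (int l) ** Y (int (k - l))) = (if k = 0 then mat 1 else 0)"
    for X Y :: "int \<Rightarrow> 'm cblock" and i k lo hi
  proof (cases "i \<le> k")
    case True
    have "(\<Sum>j = lo..hi. X (j - i) ** Y (k - j)) = (\<Sum>j = i..k. X (j - i) ** Y (k - j))"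
    proof (rule sum.mono_neutral_right)
      show "\<forall>j\<in>{lo..hi} - {i..k}. X (j - i) ** Y (k - j) = 0"
      proof
        fix j assume "j \<in> {lo..hi} - {i..k}"
        then have "X (j - i) = 0 \<or> Y (k - j) = 0"
          using X[of "j - i"] Y[of "k - j"] by auto
        then show "X (j - i) ** Y (k - j) = 0"
          by (auto simp: zero_block_mult)
      qed
    qed (use i k in auto)
    also have "\<dots> = (\<Sum>l\<le>nat (k - i). X (int l) ** Y (int (nat (k - i) - l)))"
      by (rule sum.reindex_bij_witness[of _ "\<lambda>l. i + int l" "\<lambda>j. nat (j - i)"])
        (use True in \<open>auto simp: of_nat_diff\<close>)
    also have "\<dots> = (if i = k then mat 1 else 0)"
      unfolding XY using True by auto
    finally show ?thesis .
  next
    case False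
    have "X (j - i) ** Y (k - j) = 0" for j
    proof -
      have "X (j - i) = 0 \<or> Y (k - j) = 0"
        using X[of "j - i"] Y[of "k - j"] False by linarith
      then show ?thesis
        by (auto simp: zero_block_mult)
    qed
    then show ?thesis using False by simp
  qed
  have cneg: "c (- k) = 0" if "k < 0" for k
    using that by (intro symbol_support) auto
  have Dneg: "D k = 0" if "k < 0" for k
    using that by (simp add: D_def)
  have DE: "D (int l) = E l" for l
    by (simp add: D_def)
  have aD: "(\<Sum>l\<le>k. c (- int l) ** D (int (k - l))) = (if k = 0 then mat 1 else 0)" for k
    using aE unfolding DE a_def .
  have Da: "(\<Sum>l\<le>k. D (int l) ** c (- int (k - l))) = (if k = 0 then mat 1 else 0)" for k
    using Ea unfolding DE a_def .
  show ?thesis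
  proof (rule that[of K \<rho> D])
    show "cmod (D k $ r $ s) \<le> K * \<rho> ^ nat k" for k r s
      using E[of "nat k" r s] K \<rho> by (simp add: D_def)
    show "(\<Sum>j = lo..hi. c (i - j) ** D (k - j)) = (if i = k then mat 1 else 0)"
      if "i \<in> {lo..hi}" "k \<in> {lo..hi}" for i k lo hi
      using conv[OF that cneg Dneg aD] by simp
    show "(\<Sum>j = lo..hi. D (j - i) ** c (j - k)) = (if i = k then mat 1 else 0)"
      if "i \<in> {lo..hi}" "k \<in> {lo..hi}" for i k lo hi
      using conv[OF that Dneg cneg Da] by simp
  qed (use K \<rho> in \<open>auto simp: D_def\<close>)
qed

lemma symbol_bounded:
  assumes "toeplitz_factor b p c"
  shows "cmod (c k $ r $ s) \<le> (\<Sum>k = - int b..0. norm (c k))"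
proof (cases "k \<in> {- int b..0}")
  case True
  have "cmod (c k $ r $ s) \<le> norm (c k)"
    by (meson Finite_Cartesian_Product.norm_nth_le order_trans)
  also have "\<dots> \<le> (\<Sum>k = - int b..0. norm (c k))"
    by (rule member_le_sum) (use True in auto)
  finally show ?thesis .
qed (simp add: symbol_support[OF assms] sum_nonneg)

text \<open>
  The constants of the next bounds are left to the proofs. All that matters is that they depend
  neither on \<open>N\<close> nor on the factor \<open>U\<close> of the section.
\<close>

schematic_goal section_factor_column_bound:
  fixes p c D :: "int \<Rightarrow> 'm::{finite,linorder} cblock" and U :: "'m bmatrix" and N L :: nat
  assumes F: "toeplitz_factor b p c" and "0 \<le> K" and \<rho>: "0 < \<rho>" "\<rho> < 1"
    and decay: "\<And>k r s. cmod (D k $ r $ s) \<le> K * \<rho> ^ nat k"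
    and inverse: "\<And>i k lo hi. i \<in> {lo..hi} \<Longrightarrow> k \<in> {lo..hi} \<Longrightarrow>
      (\<Sum>j = lo..hi. c (i - j) ** D (k - j)) = (if i = k then mat 1 else 0)"
    and U: "cholesky_on (central N) (toeplitz p) U"
    and j: "fst j \<in> central N" "int b - int L \<le> fst j" and "L \<le> N"
  shows "(\<Sum>a\<in>central N \<times> UNIV. (cmod ((\<Sum>k\<in>central N \<times> UNIV.
      scalar_entry U a k * D (fst j - fst k) $ snd k $ snd j) - (if a = j then 1 else 0)))\<^sup>2)
    \<le> ?C * (\<rho> ^ (N - L))\<^sup>2"
proof -
  note symbol_support = symbol_support[OF F]
  define J where "J = central N \<times> (UNIV :: 'm set)"
  define J' where "J' = {- int N - int b..int N} \<times> (UNIV :: 'm set)"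
  define C where "C = scalar_entry (toeplitz c)"
  define u where "u k = D (fst j - fst k) $ snd k $ snd j" for k
  define B where "B = (\<Sum>k = - int b..0. norm (c k))"
  have B0: "B \<ge> 0"
    by (simp add: B_def sum_nonneg)
  have CT: "upper_triangular_on UNIV (toeplitz c)"
    using F by (simp add: toeplitz_factor_def cholesky_on_def)
  have J: "finite J" "finite J'" "J \<subseteq> J'"
    by (auto simp: J_def J'_def central_def)
  have UT: "upper_triangular_on (central N) U" and UD: "positive_diagonal_on (central N) U"
    using U by (auto simp: cholesky_on_def)
  have "(\<Sum>a\<in>J. (cmod ((\<Sum>k\<in>J. scalar_entry U a k * u k) - (if a = j then 1 else 0)))\<^sup>2) \<le>
      2 * (\<Sum>a\<in>J' - J. (cmod (\<Sum>k\<in>J. C a k * u k))\<^sup>2)"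
  proof (rule triangular_gram_column_bound[OF J(2,3) transp_block_prec irreflp_block_prec])
    show "j \<in> J"
      using j(1) by (cases j) (auto simp: J_def)
    show "scalar_entry U a k = 0" if "a \<in> J" "k \<in> J" "a \<noteq> k" "\<not> block_prec a k" for a k
      using that by (intro upper_triangular_scalar_entry[OF UT]) (auto simp: J_def)
    show "Im (scalar_entry U a a) = 0 \<and> 0 < Re (scalar_entry U a a)" if "a \<in> J" for a
      using UD that by (auto simp: positive_diagonal_on_def scalar_entry_def J_def)
    show "C a k = 0" if "a \<noteq> k" "\<not> block_prec a k" for a k
      unfolding C_def using that by (intro upper_triangular_scalar_entry[OF CT]) auto
    show "Im (C a a) = 0 \<and> 0 < Re (C a a)" for a
      using symbol_0_diagonal[OF F] by (simp add: C_def scalar_entry_def toeplitz_def)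
    show "(\<Sum>k\<in>J. cnj (scalar_entry U k a1) * scalar_entry U k a2) =
        (\<Sum>k\<in>J'. cnj (C k a1) * C k a2)" if "a1 \<in> J" "a2 \<in> J" for a1 a2
    proof -
      obtain i r i' s where a: "a1 = (i, r)" "a2 = (i', s)"
        by (metis surj_pair)
      then have i: "i \<in> central N" "i' \<in> central N"
        using that by (auto simp: J_def)
      have "(\<Sum>k\<in>J. cnj (scalar_entry U k a1) * scalar_entry U k a2) =
          (\<Sum>k\<in>central N. cadjoint (U k i) ** U k i') $ r $ s"
        by (simp only: scalar_entry_gram a J_def)
      also have "(\<Sum>k\<in>central N. cadjoint (U k i) ** U k i') = toeplitz p i i'"
        using U i by (simp add: cholesky_on_def central_def)
      also have "\<dots> = (\<Sum>k = - int N - int b..int N. cadjoint (c (k - i)) ** c (k - i'))"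
        unfolding toeplitz_def by (rule product_entry[OF F]) (use i in \<open>auto simp: central_def\<close>)
      also have "\<dots> = (\<Sum>k = - int N - int b..int N.
          cadjoint (toeplitz c k i) ** toeplitz c k i')"
        by (simp add: toeplitz_def)
      also have "\<dots> $ r $ s = (\<Sum>k\<in>J'. cnj (C k a1) * C k a2)"
        by (simp only: scalar_entry_gram a J'_def C_def)
      finally show ?thesis .
    qed
    show "(\<Sum>k\<in>J. C a k * u k) = (if a = j then 1 else 0)" if "a \<in> J" for a
    proof -
      have "(\<Sum>k\<in>J. C a k * u k) =
          (\<Sum>k\<in>J. C (fst a, snd a) k * scalar_entry (\<lambda>k j. D (j - k)) k (fst j, snd j))"
        by (simp add: u_def scalar_entry_def)
      also have "\<dots> = (\<Sum>k\<in>central N. toeplitz c (fst a) k ** D (fst j - k)) $ snd a $ snd j"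
        unfolding C_def J_def by (rule scalar_entry_mult[symmetric])
      also have "(\<Sum>k\<in>central N. toeplitz c (fst a) k ** D (fst j - k)) =
          (if fst a = fst j then mat 1 else 0)"
        unfolding toeplitz_def central_def
        by (rule inverse) (use that j in \<open>auto simp: J_def central_def\<close>)
      also have "\<dots> $ snd a $ snd j = (if a = j then 1 else 0)"
        by (auto simp: mat_def prod_eq_iff)
      finally show ?thesis .
    qed
  qed
  also have "(\<Sum>a\<in>J' - J. (cmod (\<Sum>k\<in>J. C a k * u k))\<^sup>2) \<le>
      real (b * CARD('m)) * (real (b * CARD('m)) * (B * (K * \<rho> ^ (N - L))))\<^sup>2"
  proof -
    have JJ: "J' - J = {- int N - int b..- int N - 1} \<times> UNIV"
      by (auto simp: J_def J'_def central_def)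
    define T where "T = {- int N..- int N + int b - 1} \<times> (UNIV :: 'm set)"
    have T: "finite T" "card T = b * CARD('m)"
      by (simp_all add: T_def card_cartesian_product)
    have "cmod (\<Sum>k\<in>J. C a k * u k) \<le> real (b * CARD('m)) * (B * (K * \<rho> ^ (N - L)))"
      if a: "a \<in> J' - J" for a
    proof -
      have "(\<Sum>k\<in>J. C a k * u k) = (\<Sum>k\<in>J \<inter> T. C a k * u k)"
      proof (rule sum.mono_neutral_right)
        show "\<forall>k\<in>J - J \<inter> T. C a k * u k = 0"
        proof
          fix k assume "k \<in> J - J \<inter> T"
          moreover have "fst a \<le> - int N - 1"
            using a unfolding JJ by auto
          ultimately have "fst a - fst k \<notin> {- int b..0}"
            by (auto simp: T_def J_def central_def)
          then show "C a k * u k = 0"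
            by (simp add: C_def scalar_entry_def toeplitz_def symbol_support)
        qed
      qed (use J in auto)
      also have "cmod \<dots> \<le> (\<Sum>k\<in>J \<inter> T. B * (K * \<rho> ^ (N - L)))"
      proof (rule sum_norm_le)
        fix k assume k: "k \<in> J \<inter> T"
        have "cmod (u k) \<le> K * \<rho> ^ nat (fst j - fst k)"
          unfolding u_def by (rule decay)
        also have "\<dots> \<le> K * \<rho> ^ (N - L)"
        proof (intro mult_left_mono power_decreasing)
          show "N - L \<le> nat (fst j - fst k)"
            using k j(2) \<open>L \<le> N\<close> by (auto simp: T_def)
        qed (use \<rho> \<open>0 \<le> K\<close> in auto)
        finally have "cmod (u k) \<le> K * \<rho> ^ (N - L)" .
        moreover have "cmod (C a k) \<le> B"
          unfolding C_def scalar_entry_def toeplitz_def B_def by (rule symbol_bounded[OF F])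
        ultimately show "cmod (C a k * u k) \<le> B * (K * \<rho> ^ (N - L))"
          unfolding norm_mult using B0 by (intro mult_mono) auto
      qed
      also have "\<dots> \<le> real (card T) * (B * (K * \<rho> ^ (N - L)))"
        unfolding sum_constant
        using B0 \<open>0 \<le> K\<close> \<rho> T by (intro mult_right_mono of_nat_mono card_mono) auto
      finally show ?thesis using T by simp
    qed
    then have "(\<Sum>a\<in>J' - J. (cmod (\<Sum>k\<in>J. C a k * u k))\<^sup>2) \<le>
        (\<Sum>a\<in>J' - J. (real (b * CARD('m)) * (B * (K * \<rho> ^ (N - L))))\<^sup>2)"
      by (intro sum_mono power_mono) auto
    also have "\<dots> = real (b * CARD('m)) * (real (b * CARD('m)) * (B * (K * \<rho> ^ (N - L))))\<^sup>2"
      by (simp add: JJ card_cartesian_product)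
    finally show ?thesis .
  qed
  finally have "(\<Sum>a\<in>J. (cmod ((\<Sum>k\<in>J. scalar_entry U a k * u k) - (if a = j then 1 else 0)))\<^sup>2) \<le>
      2 * (real (b * CARD('m)) * (real (b * CARD('m)) * (B * (K * \<rho> ^ (N - L))))\<^sup>2)"
    by simp
  also have "\<dots> =
      2 * real (b * CARD('m)) * (real (b * CARD('m)) * B * K)\<^sup>2 * (\<rho> ^ (N - L))\<^sup>2"
    by (simp add: power_mult_distrib mult_ac)
  finally show "(\<Sum>a\<in>central N \<times> UNIV. (cmod ((\<Sum>k\<in>central N \<times> UNIV.
      scalar_entry U a k * D (fst j - fst k) $ snd k $ snd j) - (if a = j then 1 else 0)))\<^sup>2)
    \<le> 2 * real (b * CARD('m)) *
      (real (b * CARD('m)) * (\<Sum>k = - int b..0. norm (c k)) * K)\<^sup>2 * (\<rho> ^ (N - L))\<^sup>2"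
    unfolding u_def J_def B_def .
qed

lemma section_error_expansion:
  fixes p c D :: "int \<Rightarrow> 'm::{finite,linorder} cblock" and U :: "'m bmatrix" and M N :: nat
  assumes F: "toeplitz_factor b p c" and inverse: "\<And>i k lo hi. i \<in> {lo..hi} \<Longrightarrow> k \<in> {lo..hi} \<Longrightarrow>
      (\<Sum>j = lo..hi. D (j - i) ** c (j - k)) = (if i = k then mat 1 else 0)"
    and supp: "\<And>i. i \<notin> {- int M..int M} \<Longrightarrow> \<delta> i = 0"
    and N: "M + b \<le> N" and i: "i \<in> central N"
  shows "bmatrix_apply (zero_extend N U - toeplitz c) \<delta> i $ r =
    (\<Sum>j\<in>{- int (M + b)..int M} \<times> UNIV. bmatrix_apply (toeplitz c) \<delta> (fst j) $ snd j *
      ((\<Sum>k\<in>central N \<times> UNIV. scalar_entry U (i, r) k * D (fst j - fst k) $ snd k $ snd j) -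
        (if (i, r) = j then 1 else 0)))"
proof -
  note symbol_support = symbol_support[OF F]
  define J where "J = central N \<times> (UNIV :: 'm set)"
  define C where "C = scalar_entry (toeplitz c)"
  define T where "T = {- int (M + b)..int M} \<times> (UNIV :: 'm set)"
  define v where "v j = bmatrix_apply (toeplitz c) \<delta> (fst j) $ snd j" for j
  define x where "x k = \<delta> (fst k) $ snd k" for k
  define u where "u j k = D (fst j - fst k) $ snd k $ snd j" for j k
  have J: "finite J" and T: "T \<subseteq> J" and ir: "(i, r) \<in> J"
    using N i by (auto simp: J_def T_def central_def)
  have fin: "finite (central N)" and supp': "\<And>i. i \<notin> central N \<Longrightarrow> \<delta> i = 0"
    using N by (auto simp: central_def intro!: supp)
  have v: "v j = (\<Sum>k\<in>J. C j k * x k)" for j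
    unfolding v_def C_def J_def x_def by (subst bmatrix_apply_nth[OF fin supp']) auto
  have v0: "v j = 0" if "j \<notin> T" for j
    unfolding v
  proof (intro sum.neutral ballI)
    fix k
    show "C j k * x k = 0"
    proof (cases "fst k \<in> {- int M..int M}")
      case True
      have "fst j - fst k \<notin> {- int b..0}"
        using that True by (cases j) (auto simp: T_def)
      then show ?thesis
        by (simp add: C_def scalar_entry_def toeplitz_def symbol_support)
    qed (simp add: x_def supp)
  qed
  have expand: "x k = (\<Sum>j\<in>T. v j * u j k)" if "k \<in> J" for k
  proof -
    have "(\<Sum>j\<in>T. v j * u j k) = (\<Sum>j\<in>J. v j * u j k)"
      by (rule sum.mono_neutral_left) (use J T v0 in auto)
    also have "\<dots> = (\<Sum>j\<in>J. \<Sum>l\<in>J. u j k * C j l * x l)"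
      unfolding v sum_distrib_right by (simp add: mult_ac)
    also have "\<dots> = (\<Sum>l\<in>J. \<Sum>j\<in>J. u j k * C j l * x l)"
      by (rule sum.swap)
    also have "\<dots> = (\<Sum>l\<in>J. if l = k then x l else 0)"
    proof (intro sum.cong refl)
      fix l assume "l \<in> J"
      have "(\<Sum>j\<in>J. u j k * C j l) =
          (\<Sum>j\<in>J. scalar_entry (\<lambda>k j. D (j - k)) (fst k, snd k) j * C j (fst l, snd l))"
        by (simp add: u_def scalar_entry_def)
      also have "\<dots> = (\<Sum>j\<in>central N. D (j - fst k) ** toeplitz c j (fst l)) $ snd k $ snd l"
        unfolding C_def J_def by (rule scalar_entry_mult[symmetric])
      also have "(\<Sum>j\<in>central N. D (j - fst k) ** toeplitz c j (fst l)) =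
          (if fst k = fst l then mat 1 else 0)"
        unfolding toeplitz_def central_def
        by (rule inverse) (use \<open>k \<in> J\<close> \<open>l \<in> J\<close> in \<open>auto simp: J_def central_def\<close>)
      also have "\<dots> $ snd k $ snd l = (if l = k then 1 else 0)"
        by (auto simp: mat_def prod_eq_iff)
      finally show "(\<Sum>j\<in>J. u j k * C j l * x l) = (if l = k then x l else 0)"
        by (simp flip: sum_distrib_right)
    qed
    also have "\<dots> = x k"
      using J that by simp
    finally show ?thesis by simp
  qed
  have "bmatrix_apply (zero_extend N U - toeplitz c) \<delta> i $ r =
      (\<Sum>k\<in>J. scalar_entry (zero_extend N U - toeplitz c) (i, r) k * x k)"
    unfolding J_def x_def by (rule bmatrix_apply_nth[OF fin supp'])
  also have "\<dots> = (\<Sum>k\<in>J. scalar_entry U (i, r) k * x k) - (\<Sum>k\<in>J. C (i, r) k * x k)"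
    unfolding sum_subtractf[symmetric] using i
    by (intro sum.cong refl)
      (auto simp: scalar_entry_def zero_extend_def C_def J_def algebra_simps)
  also have "(\<Sum>k\<in>J. C (i, r) k * x k) = (\<Sum>j\<in>T. v j * (if (i, r) = j then 1 else 0))"
  proof -
    have "(\<Sum>j\<in>T. v j * (if (i, r) = j then 1 else 0)) =
        (\<Sum>j\<in>J. v j * (if (i, r) = j then 1 else 0))"
      by (rule sum.mono_neutral_left) (use J T v0 in auto)
    also have "\<dots> = (\<Sum>j\<in>J. if (i, r) = j then v j else 0)"
      by (intro sum.cong) auto
    also have "\<dots> = v (i, r)"
      using J ir by simp
    finally show ?thesis by (simp add: v)
  qed
  also have "(\<Sum>k\<in>J. scalar_entry U (i, r) k * x k) =
      (\<Sum>k\<in>J. \<Sum>j\<in>T. v j * (scalar_entry U (i, r) k * u j k))"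
    by (intro sum.cong refl) (simp add: expand sum_distrib_left mult_ac)
  also have "\<dots> = (\<Sum>j\<in>T. v j * (\<Sum>k\<in>J. scalar_entry U (i, r) k * u j k))"
    by (subst sum.swap) (simp add: sum_distrib_left)
  also have "\<dots> - (\<Sum>j\<in>T. v j * (if (i, r) = j then 1 else 0)) =
      (\<Sum>j\<in>T. v j * ((\<Sum>k\<in>J. scalar_entry U (i, r) k * u j k) - (if (i, r) = j then 1 else 0)))"
    by (simp only: right_diff_distrib sum_subtractf)
  finally show ?thesis
    unfolding J_def T_def v_def u_def .
qed

schematic_goal section_error_bound:
  fixes p c D :: "int \<Rightarrow> 'm::{finite,linorder} cblock" and U :: "'m bmatrix" and M N :: nat
  assumes F: "toeplitz_factor b p c" and K: "0 \<le> K" and \<rho>: "0 < \<rho>" "\<rho> < 1"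
    and decay: "\<And>k r s. cmod (D k $ r $ s) \<le> K * \<rho> ^ nat k"
    and CD: "\<And>i k lo hi. i \<in> {lo..hi} \<Longrightarrow> k \<in> {lo..hi} \<Longrightarrow>
      (\<Sum>j = lo..hi. c (i - j) ** D (k - j)) = (if i = k then mat 1 else 0)"
    and DC: "\<And>i k lo hi. i \<in> {lo..hi} \<Longrightarrow> k \<in> {lo..hi} \<Longrightarrow>
      (\<Sum>j = lo..hi. D (j - i) ** c (j - k)) = (if i = k then mat 1 else 0)"
    and supp: "\<And>i. i \<notin> {- int M..int M} \<Longrightarrow> \<delta> i = 0"
    and U: "cholesky_on (central N) (toeplitz p) U"
    and N: "M + 2 * b \<le> N"
  shows "ell2_norm (bmatrix_apply (zero_extend N U - toeplitz c) \<delta>) \<le> ?G * \<rho> ^ (N - (M + 2 * b))"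
proof -
  define L where "L = M + 2 * b"
  define T where "T = {- int (M + b)..int M} \<times> (UNIV :: 'm set)"
  define v where "v j = bmatrix_apply (toeplitz c) \<delta> (fst j) $ snd j" for j
  define C where "C = 2 * real (b * CARD('m)) *
    (real (b * CARD('m)) * (\<Sum>k = - int b..0. norm (c k)) * K)\<^sup>2"
  define Q where "Q = (\<Sum>j\<in>T. (cmod (v j))\<^sup>2) * (real (card T) * C)"
  have Q: "Q \<ge> 0"
    by (simp add: Q_def C_def sum_nonneg)
  define J where "J = central N \<times> (UNIV :: 'm set)"
  define \<eta> where "\<eta> j a = (\<Sum>k\<in>J. scalar_entry U a k * D (fst j - fst k) $ snd k $ snd j) -
    (if a = j then 1 else 0)" for j a
  define y where "y = bmatrix_apply (zero_extend N U - toeplitz c) \<delta>"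
  have "L \<le> N"
    using N by (simp add: L_def)
  have fin: "finite (central N)"
    by (simp add: central_def)
  have outside: "y i = 0" if "i \<notin> central N" for i
  proof -
    have "(zero_extend N U - toeplitz c) i k *v \<delta> k = 0" for k
    proof (cases "k \<in> {- int M..int M}")
      case True
      have "i - k \<notin> {- int b..0}"
        using True that \<open>L \<le> N\<close> by (auto simp: central_def L_def)
      then show ?thesis
        using that by (simp add: zero_extend_def toeplitz_def symbol_support[OF F])
    qed (simp add: supp)
    then show ?thesis by (simp add: y_def bmatrix_apply_def)
  qed
  have column: "(\<Sum>a\<in>J. (cmod (\<eta> j a))\<^sup>2) \<le> C * (\<rho> ^ (N - L))\<^sup>2" if "j \<in> T" for j
    unfolding \<eta>_def J_def C_def
    by (rule section_factor_column_bound[OF F K \<rho> decay CD U])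
      (use that \<open>L \<le> N\<close> in \<open>auto simp: T_def L_def central_def\<close>)
  have "(ell2_norm y)\<^sup>2 = (\<Sum>a\<in>J. (cmod (y (fst a) $ snd a))\<^sup>2)"
    unfolding J_def by (rule ell2_norm_finite_support[OF fin outside])
  also have "\<dots> \<le> (\<Sum>a\<in>J. (\<Sum>j\<in>T. (cmod (v j))\<^sup>2) * (\<Sum>j\<in>T. (cmod (\<eta> j a))\<^sup>2))"
  proof (intro sum_mono)
    fix a assume "a \<in> J"
    then have a: "fst a \<in> central N" by (auto simp: J_def)
    have "y (fst a) $ snd a = (\<Sum>j\<in>T. v j * \<eta> j a)"
      unfolding y_def T_def v_def \<eta>_def J_def
      by (subst section_error_expansion[OF F DC supp _ a]) (use \<open>L \<le> N\<close> in \<open>auto simp: L_def\<close>)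
    then show "(cmod (y (fst a) $ snd a))\<^sup>2 \<le>
        (\<Sum>j\<in>T. (cmod (v j))\<^sup>2) * (\<Sum>j\<in>T. (cmod (\<eta> j a))\<^sup>2)"
      using cmod_sum_cnj_mult_squared_le[of "\<lambda>j. cnj (v j)" "\<lambda>j. \<eta> j a" T] by simp
  qed
  also have "\<dots> = (\<Sum>j\<in>T. (cmod (v j))\<^sup>2) * (\<Sum>j\<in>T. \<Sum>a\<in>J. (cmod (\<eta> j a))\<^sup>2)"
    unfolding sum_distrib_left[symmetric] by (subst sum.swap) (rule refl)
  also have "\<dots> \<le> (\<Sum>j\<in>T. (cmod (v j))\<^sup>2) * (\<Sum>j\<in>T. C * (\<rho> ^ (N - L))\<^sup>2)"
    by (intro mult_left_mono sum_mono column sum_nonneg) auto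
  also have "\<dots> = (sqrt Q * \<rho> ^ (N - L))\<^sup>2"
    using Q by (simp add: Q_def power_mult_distrib mult_ac)
  finally have "ell2_norm y \<le> sqrt Q * \<rho> ^ (N - L)"
    by (rule power2_le_imp_le) (use Q \<rho> in auto)
  then show "ell2_norm (bmatrix_apply (zero_extend N U - toeplitz c) \<delta>) \<le>
      sqrt ((\<Sum>j\<in>{- int (M + b)..int M} \<times> (UNIV :: 'm set).
          (cmod (bmatrix_apply (toeplitz c) \<delta> (fst j) $ snd j))\<^sup>2) *
        (real (card ({- int (M + b)..int M} \<times> (UNIV :: 'm set))) *
          (2 * real (b * CARD('m)) *
            (real (b * CARD('m)) * (\<Sum>k = - int b..0. norm (c k)) * K)\<^sup>2))) *
        \<rho> ^ (N - (M + 2 * b))"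
    unfolding y_def Q_def C_def v_def T_def L_def .
qed

theorem theorem3p1:
  fixes p c :: "int \<Rightarrow> 'm::{finite,linorder} cblock"
    and n b :: nat
    and CN :: "nat \<Rightarrow> 'm bmatrix"
    and \<delta> :: "'m vseq"
  assumes "\<And>k. \<bar>k\<bar> > int n \<Longrightarrow> p k = 0"
    and "\<And>z. cmod z = 1 \<Longrightarrow> positive_definite (laurent n p z)"
    and "banded b (toeplitz c)"
    and "cholesky_on UNIV (toeplitz p) (toeplitz c)"
    and "canonical_symbol b c"
    and "\<And>N. cholesky_on (central N) (toeplitz p) (CN N)"
    and "\<delta> \<in> ell2"
    and "finite {i. \<delta> i \<noteq> 0}"
  shows "\<exists>K > 0. \<exists>\<rho>. 0 < \<rho> \<and> \<rho> < 1 \<and>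
           (\<forall>N. ell2_norm (bmatrix_apply (zero_extend N (CN N) - toeplitz c) \<delta>) < K * \<rho> ^ N)"
proof -
  have F: "toeplitz_factor b p c"
    using assms(3,4) by (simp add: toeplitz_factor_def)
  obtain D :: "int \<Rightarrow> 'm cblock" and K \<rho> :: real where K: "0 \<le> K" and \<rho>: "0 < \<rho>" "\<rho> < 1"
    and decay: "\<And>k r s. cmod (D k $ r $ s) \<le> K * \<rho> ^ nat k"
    and CD: "\<And>i k lo hi. i \<in> {lo..hi} \<Longrightarrow> k \<in> {lo..hi} \<Longrightarrow>
      (\<Sum>j = lo..hi. c (i - j) ** D (k - j)) = (if i = k then mat 1 else 0)"
    and DC: "\<And>i k lo hi. i \<in> {lo..hi} \<Longrightarrow> k \<in> {lo..hi} \<Longrightarrow>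
      (\<Sum>j = lo..hi. D (j - i) ** c (j - k)) = (if i = k then mat 1 else 0)"
    by (rule symbol_inverse[OF F assms(1,2,5)]) blast+
  obtain m where m: "\<And>i. \<delta> i \<noteq> 0 \<Longrightarrow> \<bar>i\<bar> < m"
    using assms(8) by (auto simp: finite_int_iff_bounded image_subset_iff)
  have supp: "\<delta> i = 0" if "i \<notin> {- int (nat m)..int (nat m)}" for i
    using m[of i] that by (cases "\<delta> i = 0") (auto split: if_splits)
  have "\<exists>K>0. \<forall>N. ell2_norm (bmatrix_apply (zero_extend N (CN N) - toeplitz c) \<delta>) < K * \<rho> ^ N"
    by (rule geometric_bound_of_eventual[OF \<rho>(1) ell2_norm_nonneg])
      (rule section_error_bound[OF F K \<rho> decay CD DC supp assms(6)])
  then show ?thesis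
    using \<rho> by blast
qed

end
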